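(* Let $M$ be a discrete median algebra and $X\subseteq M$. The following are equivalent. (i) $M$ is generated by $X$ (as a median algebra). (ii) The map $\mathrm{res}_X: M^\circ\to\mathscr{P}X$, $H\mapsto H\cap X$, is an embedding of poc sets.
   Context: A median algebra is a nonempty set $M$ with a map $m: M^3\to M$ such that: $m(x,y,z)=m(x,z,y)=m(y,z,x)$; $m(x,x,y)=x$; $m(m(x,y,z),u,v)=m(x,m(y,u,v),m(z,u,v))$. A subset $C\subseteq M$ is convex if $m(x,y,z)\in C$ for all $x,y\in C$, $z\in M$. A half space is a subset $H\subseteq M$ with $H$ and $M\setminus H$ both convex. $M$ is discrete if for all $x,y\in M$ only finitely many half spaces contain $x$ but not $y$. $M^\circ$ is the set of half spaces of $M$ ordered by inclusion with $H^*=M\setminus H$ and $0=\varnothing$. The power set $\mathscr{P}X$ is ordered by inclusion with $a^*=X\setminus a$ and $0=\varnothing$. A poc morphism $g$ (a monotone map fixing $0$ and commuting with $^*$) is an embedding if it is an isomorphism onto its image, i.e. $g(a)\le g(b)\Rightarrow a\le b$ for all $a,b$. *)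

theory Defs
  imports Main "HOL.Hull" "HOL-Algebra.Congruence"
begin

locale median_algebra =
  fixes M :: "'a set" and m :: "'a \<Rightarrow> 'a \<Rightarrow> 'a \<Rightarrow> 'a"
  assumes nonempty: "M \<noteq> {}"
    and closed: "\<lbrakk>x \<in> M; y \<in> M; z \<in> M\<rbrakk> \<Longrightarrow> m x y z \<in> M"
    and swap: "\<lbrakk>x \<in> M; y \<in> M; z \<in> M\<rbrakk> \<Longrightarrow> m x y z = m x z y"
    and rotate: "\<lbrakk>x \<in> M; y \<in> M; z \<in> M\<rbrakk> \<Longrightarrow> m x y z = m y z x"
    and majority: "\<lbrakk>x \<in> M; y \<in> M\<rbrakk> \<Longrightarrow> m x x y = x"
    and distrib: "\<lbrakk>x \<in> M; y \<in> M; z \<in> M; u \<in> M; v \<in> M\<rbrakk>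
      \<Longrightarrow> m (m x y z) u v = m x (m y u v) (m z u v)"

definition median_convex :: "'a set \<Rightarrow> ('a \<Rightarrow> 'a \<Rightarrow> 'a \<Rightarrow> 'a) \<Rightarrow> 'a set \<Rightarrow> bool" where
  "median_convex M m C \<longleftrightarrow> C \<subseteq> M \<and> (\<forall>x\<in>C. \<forall>y\<in>C. \<forall>z\<in>M. m x y z \<in> C)"

definition half_space :: "'a set \<Rightarrow> ('a \<Rightarrow> 'a \<Rightarrow> 'a \<Rightarrow> 'a) \<Rightarrow> 'a set \<Rightarrow> bool" where
  "half_space M m H \<longleftrightarrow> H \<subseteq> M \<and> median_convex M m H \<and> median_convex M m (M - H)"

locale discrete_median_algebra = median_algebra +
  assumes discrete: "\<lbrakk>x \<in> M; y \<in> M\<rbrakk> \<Longrightarrow> finite {H. half_space M m H \<and> x \<in> H \<and> y \<notin> H}"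

text \<open>The empty set counts as closed under the median, so the empty set generates only itself
  (and hence never a median algebra, which is nonempty).\<close>

definition median_closed :: "'a set \<Rightarrow> ('a \<Rightarrow> 'a \<Rightarrow> 'a \<Rightarrow> 'a) \<Rightarrow> 'a set \<Rightarrow> bool" where
  "median_closed M m S \<longleftrightarrow> S \<subseteq> M \<and> (\<forall>x\<in>S. \<forall>y\<in>S. \<forall>z\<in>S. m x y z \<in> S)"

definition median_generates :: "'a set \<Rightarrow> ('a \<Rightarrow> 'a \<Rightarrow> 'a \<Rightarrow> 'a) \<Rightarrow> 'a set \<Rightarrow> bool" where
  "median_generates M m X \<longleftrightarrow> median_closed M m hull X = M"

text \<open>The data of a poc set: a carrier, an order, an involution and a least element. Morphisms
  and embeddings refer only to this data.\<close>

record 'a poc = "'a partial_object" +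
  poc_le :: "'a \<Rightarrow> 'a \<Rightarrow> bool"
  poc_star :: "'a \<Rightarrow> 'a"
  poc_zero :: "'a"

definition poc_morphism :: "'a poc \<Rightarrow> 'b poc \<Rightarrow> ('a \<Rightarrow> 'b) \<Rightarrow> bool" where
  "poc_morphism P Q g \<longleftrightarrow>
     g \<in> carrier P \<rightarrow> carrier Q \<and>
     (\<forall>a\<in>carrier P. \<forall>b\<in>carrier P. poc_le P a b \<longrightarrow> poc_le Q (g a) (g b)) \<and>
     g (poc_zero P) = poc_zero Q \<and>
     (\<forall>a\<in>carrier P. g (poc_star P a) = poc_star Q (g a))"

definition poc_embedding :: "'a poc \<Rightarrow> 'b poc \<Rightarrow> ('a \<Rightarrow> 'b) \<Rightarrow> bool" where
  "poc_embedding P Q g \<longleftrightarrow> poc_morphism P Q g \<and>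
     (\<forall>a\<in>carrier P. \<forall>b\<in>carrier P. poc_le Q (g a) (g b) \<longrightarrow> poc_le P a b)"

definition half_space_poc :: "'a set \<Rightarrow> ('a \<Rightarrow> 'a \<Rightarrow> 'a \<Rightarrow> 'a) \<Rightarrow> 'a set poc" where
  "half_space_poc M m =
     \<lparr>carrier = {H. half_space M m H}, poc_le = (\<subseteq>), poc_star = (\<lambda>H. M - H), poc_zero = {}\<rparr>"

definition power_set_poc :: "'a set \<Rightarrow> 'a set poc" where
  "power_set_poc X =
     \<lparr>carrier = Pow X, poc_le = (\<subseteq>), poc_star = (\<lambda>a. X - a), poc_zero = {}\<rparr>"

end

theory Submission
  imports Defs
begin

text \<open>
  Let \<open>A\<close> and \<open>B\<close> be half spaces. Of any three points of \<open>A \<union> B\<close>, two lie in the same one of the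
  two sets, so their median does as well; hence \<open>A \<union> B\<close> is a subalgebra. If \<open>X\<close> generates
  \<open>M\<close> and \<open>A \<inter> X \<subseteq> B\<close>, then the subalgebra \<open>(M - A) \<union> B\<close> contains \<open>X\<close>, hence is all of \<open>M\<close>, and
  this says \<open>A \<subseteq> B\<close>. So the restriction map reflects the order.

  Conversely, the restriction map reflects the order only if any two half spaces \<open>A\<close>, \<open>B\<close> with a
  common point have a common point in \<open>X\<close>: otherwise \<open>A \<inter> X \<subseteq> M - B\<close>, whence \<open>A \<subseteq> M - B\<close>. Fix a
  point \<open>c\<close> of \<open>M\<close> and let \<open>N\<close> be the subalgebra generated by \<open>X\<close>. The half spaces around \<open>c\<close> meet
  pairwise inside \<open>N\<close>, so by the Helly property (\<open>helly\<close>) any finitely many of them have a common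
  point in \<open>N\<close>. Discreteness turns this into the following choice of three points of \<open>N\<close>. Take any
  \<open>n1\<close> in \<open>N\<close>; then \<open>n2\<close> in the finitely many half spaces separating \<open>c\<close> from \<open>n1\<close>; then \<open>n3\<close> in the
  finitely many half spaces separating \<open>c\<close> from \<open>n1\<close> or from \<open>n2\<close>. Every half space around \<open>c\<close>
  misses at most one of the three points, so it contains \<open>m n1 n2 n3\<close>. As half spaces separate
  points (\<open>half_space_separation\<close>), \<open>c = m n1 n2 n3\<close> is in \<open>N\<close>.

  Separation of points is Zorn's lemma: a maximal convex set containing \<open>x\<close> and not \<open>y\<close> is a half
  space.
\<close>

section \<open>The median operation as a meet with a base point\<close>

context median_algebra
begin

lemma median_commute:
  assumes "x \<in> M" "y \<in> M" "z \<in> M"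
  shows "m x y z = m y x z"
  using assms by (metis rotate swap)

lemmas median_permute = swap median_commute

text \<open>For a fixed base point \<open>t\<close>, the operation \<open>m t\<close> is a meet semilattice with least element
  \<open>t\<close>. The identities needed below all become short computations in it.\<close>

lemma meet_assoc:
  assumes "t \<in> M" "a \<in> M" "b \<in> M" "c \<in> M"
  shows "m t (m t a b) c = m t a (m t b c)"
proof -
  have "m t (m t a b) c = m (m a b t) c t"
    using assms by (simp add: closed median_permute)
  also have "\<dots> = m a (m b c t) (m t c t)"
    using assms distrib by blast
  also have "m t c t = t"
    using assms majority[of t c] swap[of t t c] by simp
  also have "m a (m b c t) t = m t a (m t b c)"
    using assms by (simp add: closed median_permute)
  finally show ?thesis .
qed

lemma meet_left_commute:
  assumes "t \<in> M" "a \<in> M" "b \<in> M" "c \<in> M"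
  shows "m t a (m t b c) = m t b (m t a c)"
  using meet_assoc[of t a b c] meet_assoc[of t b a c] swap[of t a b] assms by simp

lemma meet_idem:
  assumes "t \<in> M" "a \<in> M"
  shows "m t a a = a"
  using assms majority[of a t] rotate[of t a a] by simp

text \<open>A point between \<open>h\<close> and \<open>z\<close> lies above the meet of \<open>h\<close> and \<open>z\<close>, whatever the base point.\<close>

lemma meet_le_between:
  assumes "t \<in> M" "h \<in> M" "z \<in> M" "u \<in> M" and u: "m u h z = u"
  shows "m t (m t h z) u = m t h z"
proof -
  have "m t u t = t"
    using assms majority[of t u] swap[of t u t] by simp
  then have "m t h z = m (m t u t) h z"
    by simp
  also have "\<dots> = m t (m u h z) (m t h z)"
    using assms distrib by blast
  also have "\<dots> = m t (m t h z) u"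
    using u assms(1-4) by (simp add: closed swap[of t u])
  finally show ?thesis by simp
qed

section \<open>Half spaces separate points\<close>

text \<open>Convexity of the union of all intervals from a convex set \<open>C\<close> to a point \<open>z\<close>. If
  \<open>u\<^sub>1\<close>, \<open>u\<^sub>2\<close> lie between \<open>z\<close> and \<open>h\<^sub>1\<close>, \<open>h\<^sub>2\<close> respectively, then a point
  \<open>t = m u\<^sub>1 u\<^sub>2 v\<close> lies between \<open>z\<close> and \<open>m t h\<^sub>1 h\<^sub>2\<close>: with base point \<open>t\<close>, the meet of \<open>h\<^sub>1\<close>, \<open>h\<^sub>2\<close>
  and \<open>z\<close> is below the meet of \<open>u\<^sub>1\<close> and \<open>u\<^sub>2\<close>, which is \<open>t\<close>.\<close>

lemma convex_join:
  assumes C: "median_convex M m C" and z: "z \<in> M"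
  shows "median_convex M m {u \<in> M. \<exists>h\<in>C. m u h z = u}"
  unfolding median_convex_def
proof (intro conjI ballI)
  fix u1 u2 v
  assume "u1 \<in> {u \<in> M. \<exists>h\<in>C. m u h z = u}" "u2 \<in> {u \<in> M. \<exists>h\<in>C. m u h z = u}"
    and v: "v \<in> M"
  then obtain h1 h2 where u: "u1 \<in> M" "u2 \<in> M" and hC: "h1 \<in> C" "h2 \<in> C"
    and btw: "m u1 h1 z = u1" "m u2 h2 z = u2"
    by blast
  have h: "h1 \<in> M" "h2 \<in> M"
    using C hC unfolding median_convex_def by auto
  define t where "t = m u1 u2 v"
  have t: "t \<in> M"
    unfolding t_def using u v closed by blast
  define a where "a = m t h1 z"
  define b where "b = m t h2 z"
  have ab: "a \<in> M" "b \<in> M"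
    unfolding a_def b_def using t h z closed by auto
  have tu: "m t u1 u2 = t"
  proof -
    have "m t u1 u2 = m u1 (m u1 u2 v) u2"
      unfolding t_def using u v closed by (simp add: median_commute[of _ u1 u2])
    also have "\<dots> = m u1 u2 (m u1 u2 v)"
      using u v by (simp add: closed swap[of u1 _ u2])
    also have "\<dots> = t"
      unfolding t_def using u v by (simp add: meet_assoc[symmetric] meet_idem)
    finally show ?thesis .
  qed
  have "m t (m t h1 h2) z = m t (m t h1 h2) (m t z z)"
    using meet_idem t z by simp
  also have "\<dots> = m t a b"
    unfolding a_def b_def
    using t h z by (simp add: meet_assoc meet_left_commute closed)
  also have "\<dots> = m t (m t a u1) (m t b u2)"
    using meet_le_between[OF t h(1) z u(1) btw(1)] meet_le_between[OF t h(2) z u(2) btw(2)]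
    unfolding a_def b_def by simp
  also have "\<dots> = m t (m t a b) (m t u1 u2)"
    using t ab u by (simp add: meet_assoc meet_left_commute closed)
  also have "\<dots> = t"
    using tu t ab closed[of t a b] majority[of t "m t a b"] swap[of t t "m t a b"] by simp
  finally have "m t (m t h1 h2) z = t" .
  moreover have "m t h1 h2 \<in> C"
  proof -
    have "m h1 h2 t \<in> C"
      using C hC t unfolding median_convex_def by blast
    then show ?thesis
      using rotate[of t h1 h2] t h by simp
  qed
  ultimately show "m u1 u2 v \<in> {u \<in> M. \<exists>h\<in>C. m u h z = u}"
    using t unfolding t_def by blast
qed auto

text \<open>The reason why a maximal convex set avoiding \<open>y\<close> has a convex complement: points \<open>z\<^sub>i\<close> with
  \<open>y\<close> between \<open>h\<^sub>i\<close> and \<open>z\<^sub>i\<close> are on the far side of \<open>y\<close>, and a point \<open>w\<close> between two points on the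
  far side cannot be on the near side unless \<open>y\<close> is, since \<open>y\<close> is then a median of \<open>y\<close> and two
  near points, \<open>w\<close> and \<open>m y h\<^sub>1 h\<^sub>2\<close>.\<close>

lemma far_side_between:
  assumes M: "y \<in> M" "h1 \<in> M" "h2 \<in> M" "z1 \<in> M" "z2 \<in> M" "w \<in> M"
    and y1: "m y h1 z1 = y" and y2: "m y h2 z2 = y" and w: "m w z1 z2 = w"
  shows "m y (m y h1 h2) w = y"
proof -
  have "m y h1 w = m (m z2 z1 w) y h1"
    using w M by (simp add: median_permute)
  also have "\<dots> = m z2 (m z1 y h1) (m w y h1)"
    using M distrib by blast
  also have "m z1 y h1 = y"
    using y1 M by (simp add: median_permute)
  also have "m z2 y (m w y h1) = m y z2 (m y h1 w)"
    using M by (simp add: closed median_permute)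
  finally have eq: "m y h1 w = m y z2 (m y h1 w)" .
  have "m y (m y h1 h2) w = m y h2 (m y h1 w)"
    using M by (simp add: meet_assoc meet_left_commute closed)
  also have "\<dots> = m y h2 (m y z2 (m y h1 w))"
    using eq by simp
  also have "\<dots> = m y (m y h2 z2) (m y h1 w)"
    using M by (simp add: meet_assoc closed)
  also have "\<dots> = y"
    using y2 M by (simp add: majority closed)
  finally show ?thesis .
qed

theorem half_space_separation:
  assumes x: "x \<in> M" and y: "y \<in> M" and "x \<noteq> y"
  obtains H where "half_space M m H" "x \<in> H" "y \<notin> H"
proof -
  define \<C> where "\<C> = {C. median_convex M m C \<and> x \<in> C \<and> y \<notin> C}"
  have "{x} \<in> \<C>"
    unfolding \<C>_def median_convex_def using assms majority by auto
  moreover have "\<Union>\<K> \<in> \<C>" if "\<K> \<noteq> {}" "subset.chain \<C> \<K>" for \<K>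
  proof -
    have sub: "\<K> \<subseteq> \<C>" and chain: "\<And>A B. A \<in> \<K> \<Longrightarrow> B \<in> \<K> \<Longrightarrow> A \<subseteq> B \<or> B \<subseteq> A"
      using that(2) unfolding subset_chain_def by auto
    have "m a b c \<in> \<Union>\<K>" if a: "a \<in> \<Union>\<K>" and b: "b \<in> \<Union>\<K>" and c: "c \<in> M" for a b c
    proof -
      obtain K where "K \<in> \<K>" "a \<in> K" "b \<in> K"
        using a b chain by blast
      then show ?thesis
        using c sub unfolding \<C>_def median_convex_def by blast
    qed
    moreover have "\<Union>\<K> \<subseteq> M" "x \<in> \<Union>\<K>" "y \<notin> \<Union>\<K>"
      using sub that(1) unfolding \<C>_def median_convex_def by auto
    ultimately show ?thesis
      unfolding \<C>_def median_convex_def by blast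
  qed
  ultimately obtain H where HC: "H \<in> \<C>" and max: "\<And>K. K \<in> \<C> \<Longrightarrow> H \<subseteq> K \<Longrightarrow> K = H"
    using subset_Zorn_nonempty[of \<C>] by blast
  have H: "median_convex M m H" "x \<in> H" "y \<notin> H" and HM: "H \<subseteq> M"
    using HC unfolding \<C>_def median_convex_def by auto
  have Hclosed: "m a b c \<in> H" if "a \<in> H" "b \<in> H" "c \<in> M" for a b c
    using H(1) that unfolding median_convex_def by blast
  \<comment> \<open>By maximality, joining a point outside \<open>H\<close> to \<open>H\<close> picks up \<open>y\<close>.\<close>
  have far: "\<exists>h\<in>H. m y h z = y" if z: "z \<in> M - H" for z
  proof (rule ccontr)
    assume no: "\<not> (\<exists>h\<in>H. m y h z = y)"
    define J where "J = {u \<in> M. \<exists>h\<in>H. m u h z = u}"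
    have "H \<subseteq> J"
      unfolding J_def using HM z majority by blast
    moreover have "J \<in> \<C>"
      using convex_join[OF H(1), of z] z no H(2) \<open>H \<subseteq> J\<close> unfolding \<C>_def J_def by auto
    moreover have "z \<in> J"
      using H(2) x z swap[of z x z] majority[of z x] unfolding J_def by auto
    ultimately show False
      using max z by blast
  qed
  have "median_convex M m (M - H)"
    unfolding median_convex_def
  proof (intro conjI ballI)
    fix z1 z2 v
    assume z: "z1 \<in> M - H" "z2 \<in> M - H" and v: "v \<in> M"
    obtain h1 h2 where h: "h1 \<in> H" "h2 \<in> H" and yh: "m y h1 z1 = y" "m y h2 z2 = y"
      using far z by blast
    define w where "w = m z1 z2 v"
    have w: "w \<in> M" "m w z1 z2 = w"
    proof -
      show "w \<in> M"
        unfolding w_def using z v closed by blast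
      have "m w z1 z2 = m z1 z2 (m z1 z2 v)"
        unfolding w_def using z v rotate[of "m z1 z2 v" z1 z2] by (simp add: closed)
      also have "\<dots> = w"
        unfolding w_def using z v by (simp add: meet_assoc[symmetric] meet_idem)
      finally show "m w z1 z2 = w" .
    qed
    have hM: "h1 \<in> M" "h2 \<in> M"
      using h HM by auto
    have "w \<notin> H"
    proof
      assume wH: "w \<in> H"
      have p: "m y h1 h2 \<in> H"
        using Hclosed[OF h y] rotate[of y h1 h2] y hM by simp
      have "m y (m y h1 h2) w \<in> H"
        using Hclosed[OF p wH y] rotate[of y "m y h1 h2" w] y p w(1) HM by auto
      moreover have "m y (m y h1 h2) w = y"
        using far_side_between y hM z w yh by blast
      ultimately show False
        using H(3) by simp
    qed
    then show "m z1 z2 v \<in> M - H"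
      using w unfolding w_def by blast
  qed auto
  then have "half_space M m H"
    unfolding half_space_def using H HM by blast
  then show thesis
    using that H by blast
qed

section \<open>The Helly property\<close>

lemma convex_Int:
  assumes "median_convex M m A" "median_convex M m B"
  shows "median_convex M m (A \<inter> B)"
  using assms unfolding median_convex_def by blast

text \<open>For three sets, choose a point in each pairwise intersection; every one of the sets
  contains two of these points, hence also their median.\<close>

lemma helly_three:
  assumes conv: "median_convex M m A" "median_convex M m B" "median_convex M m C"
    and "A \<inter> B \<noteq> {}" "B \<inter> C \<noteq> {}" "A \<inter> C \<noteq> {}"
  shows "A \<inter> B \<inter> C \<noteq> {}"
proof -
  obtain p q r where pqr: "p \<in> A \<inter> B" "q \<in> B \<inter> C" "r \<in> A \<inter> C"
    using assms by blast
  have M: "p \<in> M" "q \<in> M" "r \<in> M"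
    using pqr conv unfolding median_convex_def by auto
  have "m p q r \<in> B"
    using conv(2) pqr M unfolding median_convex_def by blast
  moreover have "m q r p \<in> C" "m r p q \<in> A"
    using conv(1,3) pqr M unfolding median_convex_def by blast+
  moreover have "m q r p = m p q r" "m r p q = m p q r"
    using M rotate[of p q r] rotate[of r p q] by simp_all
  ultimately show ?thesis by auto
qed

text \<open>Intersecting all members of the family with one of them gives a smaller family which still
  meets pairwise, by the case of three sets.\<close>

theorem helly:
  assumes "finite I"
    and "\<And>i. i \<in> I \<Longrightarrow> median_convex M m (f i)"
    and "\<And>i j. i \<in> I \<Longrightarrow> j \<in> I \<Longrightarrow> f i \<inter> f j \<noteq> {}"
  shows "M \<inter> (\<Inter>i\<in>I. f i) \<noteq> {}"
  using assms
proof (induction I arbitrary: f)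
  case empty
  then show ?case using nonempty by simp
next
  case (insert k I)
  have "M \<inter> (\<Inter>i\<in>I. f k \<inter> f i) \<noteq> {}"
  proof (rule insert.IH)
    fix i j assume "i \<in> I" "j \<in> I"
    then show "median_convex M m (f k \<inter> f i)"
      using convex_Int insert.prems by blast
    have "f k \<inter> f i \<inter> f j \<noteq> {}"
      by (rule helly_three) (use insert.prems \<open>i \<in> I\<close> \<open>j \<in> I\<close> in auto)
    then show "(f k \<inter> f i) \<inter> (f k \<inter> f j) \<noteq> {}"
      by blast
  qed
  moreover have "M \<inter> f k \<noteq> {}"
    using insert.prems(1)[of k] insert.prems(2)[of k k] unfolding median_convex_def by auto
  ultimately show ?case
    by (cases "I = {}") auto
qed

section \<open>Subalgebras\<close>

lemma median_algebra_subalgebra: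
  assumes "median_closed M m N" "N \<noteq> {}"
  shows "median_algebra N m"
proof
  have sub: "N \<subseteq> M"
    using assms(1) unfolding median_closed_def by blast
  show "N \<noteq> {}" by fact
  show "m x y z \<in> N" if "x \<in> N" "y \<in> N" "z \<in> N" for x y z
    using assms(1) that unfolding median_closed_def by blast
  show "m x y z = m x z y" if "x \<in> N" "y \<in> N" "z \<in> N" for x y z
    using swap that sub by blast
  show "m x y z = m y z x" if "x \<in> N" "y \<in> N" "z \<in> N" for x y z
    using rotate that sub by blast
  show "m x x y = x" if "x \<in> N" "y \<in> N" for x y
    using majority that sub by blast
  show "m (m x y z) u v = m x (m y u v) (m z u v)"
    if "x \<in> N" "y \<in> N" "z \<in> N" "u \<in> N" "v \<in> N" for x y z u v
    using distrib that sub by blast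
qed

lemma convex_Int_subalgebra:
  assumes "median_closed M m N" "median_convex M m C"
  shows "median_convex N m (C \<inter> N)"
  using assms unfolding median_closed_def median_convex_def by blast

lemma median_closed_Un_convex:
  assumes A: "median_convex M m A" and B: "median_convex M m B"
  shows "median_closed M m (A \<union> B)"
  unfolding median_closed_def
proof (intro conjI ballI)
  show sub: "A \<union> B \<subseteq> M"
    using A B unfolding median_convex_def by blast
  fix x y z assume xyz: "x \<in> A \<union> B" "y \<in> A \<union> B" "z \<in> A \<union> B"
  then have M: "x \<in> M" "y \<in> M" "z \<in> M"
    using sub by auto
  have two: "m x y z \<in> C" if C: "median_convex M m C"
    and "x \<in> C \<and> y \<in> C \<or> y \<in> C \<and> z \<in> C \<or> z \<in> C \<and> x \<in> C" for C
  proof -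
    have "m x y z \<in> C \<or> m y z x \<in> C \<or> m z x y \<in> C"
      using that M unfolding median_convex_def by blast
    then show ?thesis
      using rotate[of x y z] rotate[of z x y] M by simp
  qed
  show "m x y z \<in> A \<union> B"
    using two[OF A] two[OF B] xyz by blast
qed

lemma median_closed_hull:
  assumes "X \<subseteq> M"
  shows "median_closed M m (median_closed M m hull X)"
proof -
  have M: "median_closed M m M"
    unfolding median_closed_def using closed by blast
  then have sub: "median_closed M m hull X \<subseteq> M"
    using assms by (simp add: hull_minimal)
  have "m x y z \<in> median_closed M m hull X"
    if "x \<in> median_closed M m hull X" "y \<in> median_closed M m hull X"
      "z \<in> median_closed M m hull X" for x y z
    unfolding hull_def
  proof (rule InterI)
    fix S assume "S \<in> {S. median_closed M m S \<and> X \<subseteq> S}"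
    then have "median_closed M m S" "median_closed M m hull X \<subseteq> S"
      by (simp_all add: hull_minimal)
    then show "m x y z \<in> S"
      using that unfolding median_closed_def by (simp add: subset_iff)
  qed
  then show ?thesis
    using sub by (subst median_closed_def) blast
qed

end

lemma half_space_Compl:
  assumes "half_space M m H"
  shows "half_space M m (M - H)"
  using assms unfolding half_space_def by (auto simp: double_diff)

section \<open>Subalgebras of discrete median algebras\<close>

text \<open>By the Helly property in \<open>N\<close>, any finitely many half spaces around \<open>c\<close> have a common point in
  \<open>N\<close>, but possibly not all of them at once. Discreteness bounds what can go wrong: a chosen point
  misses only finitely many of these half spaces, so the next one can be chosen inside all of
  those. Three points suffice because the median only needs a majority in each half space.\<close>

lemma (in discrete_median_algebra) mem_subalgebra_if_half_spaces_meet: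
  assumes N: "median_closed M m N" and c: "c \<in> M"
    and meet: "\<And>A B. half_space M m A \<Longrightarrow> half_space M m B \<Longrightarrow> c \<in> A \<Longrightarrow> c \<in> B \<Longrightarrow> A \<inter> B \<inter> N \<noteq> {}"
  shows "c \<in> N"
proof -
  have sub: "N \<subseteq> M"
    using N unfolding median_closed_def by blast
  have "half_space M m M"
    unfolding half_space_def median_convex_def using closed by auto
  then obtain n1 where n1: "n1 \<in> N"
    using meet[of M M] c by auto
  interpret N: median_algebra N m
    using median_algebra_subalgebra N n1 by blast
  have common: "\<exists>n\<in>N. \<forall>H\<in>\<H>. n \<in> H"
    if "finite \<H>" and \<H>: "\<And>H. H \<in> \<H> \<Longrightarrow> half_space M m H \<and> c \<in> H" for \<H>
  proof -
    have "N \<inter> (\<Inter>H\<in>\<H>. H \<inter> N) \<noteq> {}"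
    proof (rule N.helly)
      show "finite \<H>" by fact
      show "median_convex N m (H \<inter> N)" if "H \<in> \<H>" for H
        using convex_Int_subalgebra N \<H>[OF that] unfolding half_space_def by blast
      show "H \<inter> N \<inter> (K \<inter> N) \<noteq> {}" if "H \<in> \<H>" "K \<in> \<H>" for H K
        using meet[of H K] \<H> that by blast
    qed
    then obtain n where "n \<in> N" "n \<in> (\<Inter>H\<in>\<H>. H \<inter> N)"
      by blast
    then show ?thesis by blast
  qed
  define sep where "sep n = {H. half_space M m H \<and> c \<in> H \<and> n \<notin> H}" for n
  have fin: "finite (sep n)" if "n \<in> N" for n
    unfolding sep_def using discrete[of c n] c that sub by blast
  have sepD: "half_space M m H \<and> c \<in> H" if "H \<in> sep n" for H n
    using that unfolding sep_def by simp
  have sepI: "n \<in> H" if "half_space M m H" "c \<in> H" "H \<notin> sep n" for H n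
    using that unfolding sep_def by simp
  obtain n2 where n2: "n2 \<in> N" "\<And>H. H \<in> sep n1 \<Longrightarrow> n2 \<in> H"
    using common[OF fin[OF n1], OF sepD[of _ n1]] by blast
  obtain n3 where n3: "n3 \<in> N" "\<And>H. H \<in> sep n1 \<union> sep n2 \<Longrightarrow> n3 \<in> H"
  proof -
    have "finite (sep n1 \<union> sep n2)"
      using fin n1 n2(1) by simp
    then show thesis
      using common[of "sep n1 \<union> sep n2"] sepD that by blast
  qed
  define n where "n = m n1 n2 n3"
  have nN: "n \<in> N"
    unfolding n_def using N.closed n1 n2(1) n3(1) by blast
  have "n \<in> H" if H: "half_space M m H" "c \<in> H" for H
  proof -
    have "median_convex M m H"
      using H unfolding half_space_def by blast
    then have conv: "m a b d \<in> H" if "a \<in> H" "b \<in> H" "d \<in> N" for a b d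
      using that sub unfolding median_convex_def by blast
    consider "n1 \<in> H" "n2 \<in> H" | "n2 \<in> H" "n3 \<in> H" | "n3 \<in> H" "n1 \<in> H"
      using n2(2)[of H] n3(2)[of H] sepI[OF H] by blast
    then have "m n1 n2 n3 \<in> H \<or> m n2 n3 n1 \<in> H \<or> m n3 n1 n2 \<in> H"
      by cases (use conv n1 n2(1) n3(1) in simp_all)
    then show ?thesis
      unfolding n_def using N.rotate[of n1 n2 n3] N.rotate[of n3 n1 n2] n1 n2(1) n3(1) by simp
  qed
  then have "c = n"
    using half_space_separation[OF c] nN sub by (metis subsetD)
  then show ?thesis
    using nN by simp
qed

section \<open>Generating sets and restriction of half spaces\<close>

lemma poc_embedding_res_iff:
  assumes "X \<subseteq> M"
  shows "poc_embedding (half_space_poc M m) (power_set_poc X) (\<lambda>H. H \<inter> X) \<longleftrightarrow>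
    (\<forall>A B. half_space M m A \<longrightarrow> half_space M m B \<longrightarrow> A \<inter> X \<subseteq> B \<longrightarrow> A \<subseteq> B)"
proof -
  have "poc_morphism (half_space_poc M m) (power_set_poc X) (\<lambda>H. H \<inter> X)"
    unfolding poc_morphism_def half_space_poc_def power_set_poc_def using assms by auto
  then show ?thesis
    unfolding poc_embedding_def by (auto simp: half_space_poc_def power_set_poc_def)
qed

theorem proposition7p12:
  fixes M :: "'a set" and m :: "'a \<Rightarrow> 'a \<Rightarrow> 'a \<Rightarrow> 'a" and X :: "'a set"
  assumes "discrete_median_algebra M m"
    and "X \<subseteq> M"
  shows "median_generates M m X \<longleftrightarrow>
    poc_embedding (half_space_poc M m) (power_set_poc X) (\<lambda>H. H \<inter> X)"
proof -
  interpret discrete_median_algebra M m by fact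
  let ?N = "median_closed M m hull X"
  have N: "median_closed M m ?N"
    using median_closed_hull assms(2) by blast
  have XN: "X \<subseteq> ?N"
    by (rule hull_subset)
  have "?N = M \<longleftrightarrow>
    (\<forall>A B. half_space M m A \<longrightarrow> half_space M m B \<longrightarrow> A \<inter> X \<subseteq> B \<longrightarrow> A \<subseteq> B)"
  proof (intro iffI allI impI)
    fix A B
    assume gen: "?N = M" and AB: "half_space M m A" "half_space M m B" and "A \<inter> X \<subseteq> B"
    have "median_closed M m ((M - A) \<union> B)"
      using AB median_closed_Un_convex unfolding half_space_def by blast
    moreover have "X \<subseteq> (M - A) \<union> B"
      using assms(2) \<open>A \<inter> X \<subseteq> B\<close> by blast
    ultimately have "M \<subseteq> (M - A) \<union> B"
      using gen hull_minimal by metis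
    then show "A \<subseteq> B"
      using AB unfolding half_space_def by blast
  next
    assume refl: "\<forall>A B. half_space M m A \<longrightarrow> half_space M m B \<longrightarrow> A \<inter> X \<subseteq> B \<longrightarrow> A \<subseteq> B"
    have "c \<in> ?N" if c: "c \<in> M" for c
    proof (rule mem_subalgebra_if_half_spaces_meet[OF N c])
      fix A B
      assume AB: "half_space M m A" "half_space M m B" "c \<in> A" "c \<in> B"
      have "\<not> A \<inter> X \<subseteq> M - B"
        using refl half_space_Compl[OF AB(2)] AB by blast
      then show "A \<inter> B \<inter> ?N \<noteq> {}"
        using assms(2) XN by blast
    qed
    moreover have "?N \<subseteq> M"
      using N unfolding median_closed_def by blast
    ultimately show "?N = M"
      by blast
  qed
  then show ?thesis
    unfolding median_generates_def poc_embedding_res_iff[OF assms(2)] .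
qed

end
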